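(* Let $X$ be a complete median space of finite rank. Then every halfspace of $X$ is either open or closed. Moreover, if $\mathfrak{h}_1\supsetneq\dots\supsetneq\mathfrak{h}_k$ is a chain of halfspaces of $X$ with $k>2\cdot\mathrm{rank}(X)$, then the closure $\overline{\mathfrak{h}_k}$ is contained in the interior of $\mathfrak{h}_1$.
   Context: A metric space $(X,d)$ is a median space if for all $x,y,z\in X$ there is a unique point $m(x,y,z)$ lying in $I(x,y)\cap I(y,z)\cap I(z,x)$, where $I(x,y)=\{z\in X\mid d(x,y)=d(x,z)+d(z,y)\}$. A subset $C\subseteq X$ is convex if $I(x,y)\subseteq C$ for all $x,y\in C$. A halfspace is a nonempty convex subset $\mathfrak{h}\subseteq X$ whose complement $\mathfrak{h}^*=X\setminus\mathfrak{h}$ is also nonempty and convex. The rank of $X$ is the supremum of those $k\in\mathbb{N}$ such that the $k$-hypercube $\{-1,1\}^k$ (with coordinatewise median, i.e.\ majority, operation) embeds in $(X,m)$ by an injective map preserving medians; equivalently, it is the maximal cardinality of a set of pairwise-transverse halfspaces, where $\mathfrak{h},\mathfrak{k}$ are transverse if $\mathfrak{h}\cap\mathfrak{k}$, $\mathfrak{h}\cap\mathfrak{k}^*$, $\mathfrak{h}^*\cap\mathfrak{k}$, $\mathfrak{h}^*\cap\mathfrak{k}^*$ are all nonempty. *)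

theory Defs
  imports
    "HOL-Analysis.Analysis"
    "HOL-Library.Extended_Nat"
    "HOL-Library.FuncSet"
begin

definition (in metric_space) metric_interval :: "'a \<Rightarrow> 'a \<Rightarrow> 'a set" where
  "metric_interval x y = {z. dist x y = dist x z + dist z y}"

class median_space = metric_space +
  assumes ex1_median:
    "\<exists>!m. m \<in> metric_interval x y \<inter> metric_interval y z \<inter> metric_interval z x"

definition median :: "'a::median_space \<Rightarrow> 'a \<Rightarrow> 'a \<Rightarrow> 'a" where
  "median x y z =
    (THE m. m \<in> metric_interval x y \<inter> metric_interval y z \<inter> metric_interval z x)"

definition interval_convex :: "'a::median_space set \<Rightarrow> bool" where
  "interval_convex C \<longleftrightarrow> (\<forall>x\<in>C. \<forall>y\<in>C. metric_interval x y \<subseteq> C)"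

definition halfspace :: "'a::median_space set \<Rightarrow> bool" where
  "halfspace h \<longleftrightarrow> h \<noteq> {} \<and> interval_convex h \<and> - h \<noteq> {} \<and> interval_convex (- h)"

definition hypercube :: "nat \<Rightarrow> (nat \<Rightarrow> int) set" where
  "hypercube k = {..<k} \<rightarrow>\<^sub>E {-1, 1}"

text \<open>For signs, the majority is the sign of the sum. The restriction to \<open>{..<k}\<close> keeps
  the result inside the extensional function space.\<close>

definition hypercube_median ::
  "nat \<Rightarrow> (nat \<Rightarrow> int) \<Rightarrow> (nat \<Rightarrow> int) \<Rightarrow> (nat \<Rightarrow> int) \<Rightarrow> (nat \<Rightarrow> int)" where
  "hypercube_median k u v w = (\<lambda>i\<in>{..<k}. sgn (u i + v i + w i))"

definition hypercube_embedding :: "nat \<Rightarrow> ((nat \<Rightarrow> int) \<Rightarrow> 'a::median_space) \<Rightarrow> bool" where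
  "hypercube_embedding k f \<longleftrightarrow>
    inj_on f (hypercube k) \<and>
    (\<forall>u\<in>hypercube k. \<forall>v\<in>hypercube k. \<forall>w\<in>hypercube k.
      f (hypercube_median k u v w) = median (f u) (f v) (f w))"

definition median_rank :: "'a::median_space itself \<Rightarrow> enat" where
  "median_rank _ =
    (SUP k \<in> {k. \<exists>f :: (nat \<Rightarrow> int) \<Rightarrow> 'a. hypercube_embedding k f}. enat k)"

end

theory Submission
  imports Defs
begin

text \<open>
  A projection \<open>median p q\<close> onto an interval is a nearest-point gate and a median homomorphism.
  If two intervals are disjoint, the two projections between them restrict to mutually inverse
  isomorphisms of their shores, so an \<open>n\<close>-cube in one shore doubles to an
  \<open>n + 1\<close>-cube. Both claims follow by induction on the dimension of the cube.

  If a halfspace \<open>h\<close> is neither open nor closed, pick \<open>x \<in> h\<close> in the closure of \<open>- h\<close> and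
  \<open>y \<in> - h\<close> in the closure of \<open>h\<close>. With \<open>c \<in> - h\<close> close to \<open>x\<close> and \<open>d \<in> h\<close> close to \<open>y\<close>, the
  intervals between \<open>x\<close>, \<open>c\<close> and between \<open>d\<close>, \<open>y\<close> are disjoint, and \<open>h\<close> restricted to the shore
  is again neither open nor closed; hence there are cubes of every dimension.

  If \<open>g\<^sub>0 \<supset> \<dots> \<supset> g\<^sub>n\<close> are halfspaces that do not contain \<open>x\<close> but have \<open>x\<close> in their closures, the
  same reduction discards \<open>g\<^sub>0\<close> and produces an \<open>n + 1\<close>-cube. In a chain whose members all have
  \<open>x\<close> in their frontier, this bounds the number of members avoiding \<open>x\<close> by the rank and,
  passing to complements, the number of members containing \<open>x\<close>.
\<close>

section \<open>Projections onto intervals\<close>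

lemma in_metric_interval:
  "z \<in> metric_interval x y \<longleftrightarrow> dist x y = dist x z + dist z y"
  by (simp add: metric_interval_def)

lemma metric_interval_commute: "metric_interval x y = metric_interval y x"
  by (auto simp: metric_interval_def dist_commute)

lemma left_in_interval [simp]: "x \<in> metric_interval x y"
  and right_in_interval [simp]: "y \<in> metric_interval x y"
  by (auto simp: metric_interval_def)

lemma interval_trans:
  assumes "z \<in> metric_interval x y" "w \<in> metric_interval x z"
  shows "w \<in> metric_interval x y" "z \<in> metric_interval w y"
  using assms dist_triangle[of x y w] dist_triangle[of w y z]
  by (auto simp: in_metric_interval)

lemma interval_trans_right:
  assumes "z \<in> metric_interval x y" "w \<in> metric_interval z y"
  shows "w \<in> metric_interval x y" "z \<in> metric_interval x w"
  using interval_trans[of z y x w] assms by (auto simp: metric_interval_commute)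

lemma interval_antisym:
  assumes "p \<in> metric_interval c q" "q \<in> metric_interval c p"
  shows "p = q"
  using assms by (simp add: in_metric_interval dist_commute)

lemma median_in_all:
  fixes x y z :: "'a::median_space"
  shows "median x y z \<in> metric_interval x y \<inter> metric_interval y z \<inter> metric_interval z x"
  unfolding median_def by (rule theI') (rule ex1_median)

lemma median_in_interval:
  fixes x y z :: "'a::median_space"
  shows "median x y z \<in> metric_interval x y" "median x y z \<in> metric_interval y z"
    "median x y z \<in> metric_interval x z"
  using median_in_all[of x y z] by (auto simp: metric_interval_commute)

lemma median_unique:
  fixes x y z :: "'a::median_space"
  assumes "w \<in> metric_interval x y" "w \<in> metric_interval y z" "w \<in> metric_interval x z"
  shows "median x y z = w"
proof -
  have "w \<in> metric_interval x y \<inter> metric_interval y z \<inter> metric_interval z x"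
    using assms by (auto simp: metric_interval_commute)
  then show ?thesis
    using ex1_median[of x y z] median_in_all[of x y z] by blast
qed

lemma median_perm:
  fixes x y z :: "'a::median_space"
  shows "median x y z = median y x z" "median x y z = median x z y"
  by (rule median_unique[symmetric];
      use median_in_interval in \<open>metis metric_interval_commute\<close>)+

lemma median_absorb:
  fixes x y z :: "'a::median_space"
  assumes "z \<in> metric_interval x y"
  shows "median x y z = z"
  using assms by (intro median_unique) auto

text \<open>Splitting the interval at \<open>z\<close> gives medians \<open>u\<close> and
  \<open>v\<close> of \<open>p\<close> with the two halves. The path through \<open>x\<close>,
  \<open>u\<close>, \<open>w\<close>, \<open>v\<close>, \<open>y\<close> is no longer than the one
  through \<open>z\<close>, so \<open>w\<close> is the median of \<open>x\<close>, \<open>y\<close>,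
  \<open>p\<close>; by construction it lies between \<open>z\<close> and \<open>p\<close>.\<close>

lemma median_gate:
  fixes x y z p :: "'a::median_space"
  assumes z: "z \<in> metric_interval x y"
  shows "median x y p \<in> metric_interval z p"
proof -
  define u where "u = median x z p"
  define v where "v = median z y p"
  define w where "w = median u v p"
  have u: "u \<in> metric_interval x z" "u \<in> metric_interval z p" "u \<in> metric_interval x p"
    and v: "v \<in> metric_interval z y" "v \<in> metric_interval y p" "v \<in> metric_interval z p"
    and w: "w \<in> metric_interval u v" "w \<in> metric_interval v p" "w \<in> metric_interval u p"
    unfolding u_def v_def w_def by (rule median_in_interval)+
  have "w \<in> metric_interval x p"
    using u(3) w(3) by (rule interval_trans_right)
  moreover have "w \<in> metric_interval y p"
    using v(2) w(2) by (rule interval_trans_right)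
  moreover have "w \<in> metric_interval x y"
    using z u(1) v(1) w(1) dist_triangle[of x y w] dist_triangle[of x w u]
      dist_triangle[of w y v] dist_triangle[of u v z]
    by (simp add: in_metric_interval)
  ultimately have "median x y p = w"
    by (intro median_unique)
  then show ?thesis
    using interval_trans_right(1)[OF u(2) w(3)] by simp
qed

text \<open>The gate \<open>w\<close> of \<open>c\<close> lies between \<open>c\<close> and each of
  \<open>a\<close>, \<open>b\<close>, so passing through \<open>c\<close> instead of
  \<open>w\<close> costs an extra \<open>2 * dist w c\<close>. As \<open>c\<close> is itself between
  \<open>a\<close> and \<open>b\<close>, this excess vanishes.\<close>

lemma interval_convex_interval:
  fixes x y :: "'a::median_space"
  shows "interval_convex (metric_interval x y)"
  unfolding interval_convex_def
proof (intro ballI subsetI)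
  fix a b c
  assume a: "a \<in> metric_interval x y" and b: "b \<in> metric_interval x y"
    and c: "c \<in> metric_interval a b"
  define w where "w = median x y c"
  have "w \<in> metric_interval a c" "w \<in> metric_interval b c"
    unfolding w_def using a b by (auto intro: median_gate)
  then have "dist w c = 0"
    using c dist_triangle[of a b w] zero_le_dist[of w c]
    by (simp add: in_metric_interval dist_commute)
  then show "c \<in> metric_interval x y"
    using median_in_interval(1)[of x y c] by (simp add: w_def)
qed

lemma interval_convexD:
  "interval_convex C \<Longrightarrow> a \<in> C \<Longrightarrow> b \<in> C \<Longrightarrow> z \<in> metric_interval a b \<Longrightarrow> z \<in> C"
  unfolding interval_convex_def by blast

lemma median_in_convex:
  fixes C :: "'a::median_space set"
  assumes "interval_convex C"
  shows "a \<in> C \<Longrightarrow> b \<in> C \<Longrightarrow> median a b c \<in> C"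
    "a \<in> C \<Longrightarrow> c \<in> C \<Longrightarrow> median a b c \<in> C"
    "b \<in> C \<Longrightarrow> c \<in> C \<Longrightarrow> median a b c \<in> C"
  using interval_convexD[OF assms] median_in_interval by metis+

lemma median_in_halfspace:
  fixes h :: "'a::median_space set"
  assumes "halfspace h"
  shows "a \<in> h \<Longrightarrow> b \<in> h \<Longrightarrow> median a b c \<in> h"
    "a \<in> h \<Longrightarrow> c \<in> h \<Longrightarrow> median a b c \<in> h"
    "b \<in> h \<Longrightarrow> c \<in> h \<Longrightarrow> median a b c \<in> h"
    "a \<notin> h \<Longrightarrow> b \<notin> h \<Longrightarrow> median a b c \<notin> h"
    "a \<notin> h \<Longrightarrow> c \<notin> h \<Longrightarrow> median a b c \<notin> h"
    "b \<notin> h \<Longrightarrow> c \<notin> h \<Longrightarrow> median a b c \<notin> h"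
  using assms median_in_convex(1)[of h a b c] median_in_convex(2)[of h a c b]
    median_in_convex(3)[of h b c a] median_in_convex(1)[of "- h" a b c]
    median_in_convex(2)[of "- h" a c b] median_in_convex(3)[of "- h" b c a]
  by (simp_all add: halfspace_def)

text \<open>Each gate lies between the other gate and its own point; adding the two resulting
  triangle inequalities cancels the distances to the gates.\<close>

lemma median_lipschitz:
  fixes x y p q :: "'a::median_space"
  shows "dist (median x y p) (median x y q) \<le> dist p q"
proof -
  have "median x y p \<in> metric_interval (median x y q) p"
    "median x y q \<in> metric_interval (median x y p) q"
    by (rule median_gate, rule median_in_interval)+
  then show ?thesis
    using dist_triangle[of p "median x y q" q] dist_triangle[of q "median x y p" p]
    by (simp add: in_metric_interval dist_commute)
qed

text \<open>The gate \<open>n\<close> of \<open>e\<close> in the interval of \<open>a\<close> and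
  \<open>b\<close> is also the gate of \<open>q\<close>, so going from \<open>c\<close> to
  \<open>q\<close> one may pass through \<open>n\<close> and then through \<open>e\<close>.\<close>

lemma gate_fibre_convex:
  fixes q e :: "'a::median_space"
  assumes a: "e \<in> metric_interval a q" and b: "e \<in> metric_interval b q"
    and c: "c \<in> metric_interval a b"
  shows "e \<in> metric_interval c q"
proof -
  define n where "n = median a b e"
  have n: "n \<in> metric_interval a b" "n \<in> metric_interval b e" "n \<in> metric_interval a e"
    unfolding n_def by (rule median_in_interval)+
  have "median a b q = n"
    using n(1) interval_trans(1)[OF b n(2)] interval_trans(1)[OF a n(3)]
    by (intro median_unique)
  then have "n \<in> metric_interval c q"
    using median_gate[OF c, of q] by simp
  moreover have "e \<in> metric_interval n q"
    using interval_trans(2)[OF a n(3)] .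
  ultimately show ?thesis
    by (rule interval_trans_right)
qed

text \<open>The gate \<open>e\<close> of \<open>q\<close> in the interval of the projected endpoints
  lies between \<open>q\<close> and each of \<open>a\<close>, \<open>b\<close>, hence between
  \<open>q\<close> and \<open>c\<close>. But \<open>q\<close> is the gate of \<open>c\<close>, so it
  also lies between \<open>c\<close> and \<open>e\<close>, which forces
  \<open>e = q\<close>.\<close>

lemma median_maps_interval:
  fixes x y a b c :: "'a::median_space"
  assumes c: "c \<in> metric_interval a b"
  shows "median x y c \<in> metric_interval (median x y a) (median x y b)"
proof -
  define q where "q = median x y c"
  define e where "e = median (median x y a) (median x y b) q"
  have e: "e \<in> metric_interval (median x y a) (median x y b)"
    "e \<in> metric_interval (median x y b) q" "e \<in> metric_interval (median x y a) q"
    unfolding e_def by (rule median_in_interval)+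
  have "e \<in> metric_interval d q" if "e \<in> metric_interval (median x y d) q" for d
  proof -
    have "median x y d \<in> metric_interval d q"
      using median_gate[of q x y d] by (simp add: q_def median_in_interval metric_interval_commute)
    then show ?thesis using that by (rule interval_trans_right)
  qed
  with e c have "e \<in> metric_interval c q"
    by (blast intro: gate_fibre_convex)
  moreover have "e \<in> metric_interval x y"
    using interval_convexD[OF interval_convex_interval _ _ e(1)] median_in_interval(1) by blast
  then have "q \<in> metric_interval c e"
    using median_gate[of e x y c] by (simp add: q_def metric_interval_commute)
  ultimately have "e = q"
    by (rule interval_antisym)
  with e(1) show ?thesis by (simp add: q_def)
qed

lemma median_distrib:
  fixes x y p q s :: "'a::median_space"
  shows "median x y (median p q s) = median (median x y p) (median x y q) (median x y s)"
  by (rule median_unique[symmetric]; intro median_maps_interval median_in_interval)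

lemma median_project:
  fixes x y u v p :: "'a::median_space"
  assumes "u \<in> metric_interval x y" "v \<in> metric_interval x y"
  shows "median u v (median x y p) = median u v p"
proof -
  have "median u v p \<in> metric_interval x y"
    using interval_convex_interval assms by (rule median_in_convex)
  then have "median u v p = median x y (median u v p)"
    by (simp add: median_absorb)
  also have "\<dots> = median u v (median x y p)"
    by (subst median_distrib) (simp only: median_absorb[OF assms(1)] median_absorb[OF assms(2)])
  finally show ?thesis by simp
qed

text \<open>Projecting back and forth never increases distances: comparing the lengths among
  \<open>p\<close>, \<open>q\<close>, \<open>r\<close>, \<open>w\<close> leaves no room between
  \<open>q\<close> and \<open>w\<close>. Hence the projections are mutually inverse on the
  shores.\<close>

lemma median_shore:
  fixes x y s t p :: "'a::median_space"
  assumes p: "p \<in> metric_interval s t"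
  shows "median x y (median s t (median x y p)) = median x y p"
proof -
  define q where "q = median x y p"
  define r where "r = median s t q"
  define w where "w = median x y r"
  have "q \<in> metric_interval w p" "w \<in> metric_interval q r"
    unfolding q_def w_def by (rule median_gate, rule median_in_interval)+
  moreover have "r \<in> metric_interval p q"
    unfolding r_def using p by (rule median_gate)
  ultimately have "dist q w = 0"
    using dist_triangle[of p w r] zero_le_dist[of q w]
    by (simp add: in_metric_interval dist_commute)
  then show ?thesis
    by (simp add: q_def r_def w_def)
qed

section \<open>Doubling cubes\<close>

text \<open>The inductions on dimension descend to shores, which are kept as subsets of one type
  with the ambient median.\<close>

definition median_closed :: "'a::median_space set \<Rightarrow> bool" where
  "median_closed C \<longleftrightarrow> (\<forall>a\<in>C. \<forall>b\<in>C. \<forall>c\<in>C. median a b c \<in> C)"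

lemma median_closedD:
  "median_closed C \<Longrightarrow> a \<in> C \<Longrightarrow> b \<in> C \<Longrightarrow> c \<in> C \<Longrightarrow> median a b c \<in> C"
  by (simp add: median_closed_def)

definition has_cube :: "nat \<Rightarrow> 'a::median_space set \<Rightarrow> bool" where
  "has_cube n C \<longleftrightarrow> (\<exists>f. hypercube_embedding n f \<and> f ` hypercube n \<subseteq> C)"

lemma has_cube_0:
  assumes "x \<in> C"
  shows "has_cube 0 C"
proof -
  have "hypercube_embedding 0 (\<lambda>_. x)"
    by (auto simp: hypercube_embedding_def hypercube_def median_absorb)
  with assms show ?thesis
    unfolding has_cube_def by blast
qed

lemma median_closed_shore:
  fixes C :: "'a::median_space set"
  assumes C: "median_closed C"
  shows "median_closed (median p q ` (C \<inter> metric_interval s t))"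
proof -
  have "median a b c \<in> C \<inter> metric_interval s t"
    if "a \<in> C \<inter> metric_interval s t" "b \<in> C \<inter> metric_interval s t"
      "c \<in> C \<inter> metric_interval s t" for a b c
    using that median_closedD[OF C] median_in_convex(1)[OF interval_convex_interval, of a s t b c]
    by simp
  then show ?thesis
    unfolding median_closed_def ball_simps median_distrib[symmetric] by (intro ballI imageI)
qed

text \<open>The given cube becomes the face with last coordinate \<open>-1\<close>, its projection
  to the other interval the face with \<open>1\<close>. Disjointness separates the faces, and
  \<open>median_shore\<close> makes the second projection injective on the cube.\<close>

lemma has_cube_Suc:
  fixes C :: "'a::median_space set"
  assumes C: "median_closed C" "p \<in> C" "q \<in> C" "s \<in> C" "t \<in> C"
    and disj: "metric_interval p q \<inter> metric_interval s t = {}"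
    and cube: "has_cube n (median p q ` (C \<inter> metric_interval s t))"
  shows "has_cube (Suc n) C"
proof -
  obtain f where f: "hypercube_embedding n f"
    and fC: "f ` hypercube n \<subseteq> median p q ` (C \<inter> metric_interval s t)"
    using cube unfolding has_cube_def by blast
  define cut :: "(nat \<Rightarrow> int) \<Rightarrow> nat \<Rightarrow> int" where "cut u = restrict u {..<n}" for u
  define F where "F u = (if u n = -1 then f (cut u) else median s t (f (cut u)))" for u
  have cut: "cut u \<in> hypercube n" and top: "u n = -1 \<or> u n = 1"
    if "u \<in> hypercube (Suc n)" for u
    using that by (auto simp: cut_def hypercube_def PiE_def Pi_def)
  have cut_median: "cut (hypercube_median (Suc n) u v w) = hypercube_median n (cut u) (cut v) (cut w)"
    for u v w
    by (auto simp: cut_def hypercube_median_def)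
  have cut_eq: "u = v" if "u \<in> hypercube (Suc n)" "v \<in> hypercube (Suc n)" "u n = v n" "cut u = cut v"
    for u v
  proof (rule PiE_ext)
    show "u \<in> {..<Suc n} \<rightarrow>\<^sub>E {-1, 1}" "v \<in> {..<Suc n} \<rightarrow>\<^sub>E {-1, 1}"
      using that by (auto simp: hypercube_def)
    show "u i = v i" if "i \<in> {..<Suc n}" for i
      using that \<open>u n = v n\<close> fun_cong[OF \<open>cut u = cut v\<close>, of i]
      by (auto simp: cut_def less_Suc_eq)
  qed
  have f_in: "f u \<in> C" "f u \<in> metric_interval p q" "median p q (median s t (f u)) = f u"
    if "u \<in> hypercube n" for u
    using that fC C by (auto simp: image_subset_iff median_shore median_in_interval
        intro!: median_closedD elim!: ballE[of _ _ u])
  have f_median: "f (hypercube_median n u v w) = median (f u) (f v) (f w)"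
    if "u \<in> hypercube n" "v \<in> hypercube n" "w \<in> hypercube n" for u v w
    using f that by (simp add: hypercube_embedding_def)
  have f_inj: "u = v" if "f u = f v" "u \<in> hypercube n" "v \<in> hypercube n" for u v
    using f that by (auto simp: hypercube_embedding_def dest: inj_onD)
  have "inj_on F (hypercube (Suc n))"
  proof (rule inj_onI)
    fix u v assume u: "u \<in> hypercube (Suc n)" and v: "v \<in> hypercube (Suc n)" and eq: "F u = F v"
    have "u n = v n"
      using eq top[OF u] top[OF v] f_in(2)[OF cut[OF u]] f_in(2)[OF cut[OF v]] disj
        median_in_interval(1)[of s t "f (cut u)"] median_in_interval(1)[of s t "f (cut v)"]
      by (auto simp: F_def)
    moreover from this have "f (cut u) = f (cut v)"
      using eq f_in(3)[OF cut[OF u]] f_in(3)[OF cut[OF v]] by (metis F_def)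
    ultimately show "u = v"
      using cut_eq f_inj cut u v by blast
  qed
  moreover have "F (hypercube_median (Suc n) u v w) = median (F u) (F v) (F w)"
    if u: "u \<in> hypercube (Suc n)" and v: "v \<in> hypercube (Suc n)" and w: "w \<in> hypercube (Suc n)"
    for u v w
  proof -
    let ?m = "median (f (cut u)) (f (cut v)) (f (cut w))"
    \<comment> \<open>\<open>two\<close> treats a majority of \<open>-1\<close> in the last
      coordinate: projecting to the interval of \<open>p\<close> and \<open>q\<close> brings the odd
      vertex back to its face. \<open>one\<close> treats the opposite majority.\<close>
    have two: "median a b (median s t c) = median a b c"
      if "a \<in> metric_interval p q" "b \<in> metric_interval p q"
        "median p q (median s t c) = c" for a b c
      using median_project[OF that(1,2), of "median s t c"] that(3) by simp
    have one: "median (median s t a) (median s t b) c = median s t (median a b c)" for a b c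
      unfolding median_distrib[of s t a b c]
      by (rule median_project[symmetric]) (rule median_in_interval)+
    note in_u = f_in(2,3)[OF cut[OF u]] and in_v = f_in(2,3)[OF cut[OF v]]
      and in_w = f_in(2,3)[OF cut[OF w]]
    have negative: "median (f (cut u)) (f (cut v)) (median s t (f (cut w))) = ?m"
      "median (f (cut u)) (median s t (f (cut v))) (f (cut w)) = ?m"
      "median (median s t (f (cut u))) (f (cut v)) (f (cut w)) = ?m"
      using two[OF in_u(1) in_v(1) in_w(2)] two[OF in_u(1) in_w(1) in_v(2)]
        two[OF in_v(1) in_w(1) in_u(2)] by (metis median_perm)+
    have positive: "median (f (cut u)) (median s t (f (cut v))) (median s t (f (cut w))) = median s t ?m"
      "median (median s t (f (cut u))) (f (cut v)) (median s t (f (cut w))) = median s t ?m"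
      "median (median s t (f (cut u))) (median s t (f (cut v))) (f (cut w)) = median s t ?m"
      "median (median s t (f (cut u))) (median s t (f (cut v))) (median s t (f (cut w))) = median s t ?m"
      using one[of "f (cut v)" "f (cut w)" "f (cut u)"] one[of "f (cut u)" "f (cut w)" "f (cut v)"]
        one[of "f (cut u)" "f (cut v)" "f (cut w)"]
        median_distrib[of s t "f (cut u)" "f (cut v)" "f (cut w)"] by (metis median_perm)+
    have "F (hypercube_median (Suc n) u v w) =
      (if sgn (u n + v n + w n) = -1 then ?m else median s t ?m)"
      by (simp add: F_def cut_median f_median u v w cut) (simp add: hypercube_median_def)
    also have "\<dots> = median (F u) (F v) (F w)"
      using top[OF u] top[OF v] top[OF w]
      by (elim disjE) (simp_all add: F_def negative positive)
    finally show ?thesis .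
  qed
  moreover have "F ` hypercube (Suc n) \<subseteq> C"
    using f_in(1) cut C by (auto simp: F_def intro: median_closedD)
  ultimately show ?thesis
    unfolding has_cube_def hypercube_embedding_def by blast
qed

section \<open>Cubes from halfspaces accumulating at a point\<close>

text \<open>Each of the two intervals has one endpoint in \<open>h\<close> and one outside, so
  projecting to either preserves both sides of \<open>h\<close>. Being 1-Lipschitz, the composite
  also carries the accumulation to the shore.\<close>

lemma cube_if_neither_open_nor_closed:
  fixes h :: "'a::median_space set"
  assumes "halfspace h" "median_closed C" "x \<in> C \<inter> h" "y \<in> C - h"
    and "x \<in> closure (C - h)" "y \<in> closure (C \<inter> h)"
  shows "has_cube n C"
  using assms(2-)
proof (induction n arbitrary: C x y)
  case 0
  then show ?case by (blast intro: has_cube_0)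
next
  case (Suc n)
  note h = median_in_halfspace[OF \<open>halfspace h\<close>] and C = \<open>median_closed C\<close>
  have xy: "x \<in> C" "x \<in> h" "y \<in> C" "y \<notin> h"
    using Suc.prems by auto
  have near_x: "\<exists>z\<in>C - h. dist x z < \<epsilon>" and near_y: "\<exists>z\<in>C \<inter> h. dist y z < \<epsilon>" if "\<epsilon> > 0" for \<epsilon>
    using Suc.prems that by (simp_all add: closure_approachable dist_commute)
  \<comment> \<open>A common point of the two intervals would be closer than half of
    \<open>dist x y\<close> to both \<open>x\<close> and \<open>y\<close>.\<close>
  have pos: "dist x y / 2 > 0"
    using xy by auto
  obtain c where c: "c \<in> C" "c \<notin> h" "dist x c < dist x y / 2"
    using near_x[OF pos] by blast
  obtain d where d: "d \<in> C" "d \<in> h" "dist y d < dist x y / 2"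
    using near_y[OF pos] by blast
  have disj: "metric_interval x c \<inter> metric_interval d y = {}"
  proof (rule ccontr)
    assume "\<not> ?thesis"
    then obtain z where "z \<in> metric_interval x c" "z \<in> metric_interval d y" by blast
    then show False
      using c(3) d(3) dist_triangle[of x y z] zero_le_dist[of z c] zero_le_dist[of d z]
        dist_commute[of y d]
      unfolding in_metric_interval by linarith
  qed
  let ?C = "median x c ` (C \<inter> metric_interval d y)"
  define x' where "x' = median x c (median d y x)"
  define y' where "y' = median x c (median d y y)"
  have in_C: "median x c (median d y z) \<in> ?C" if "z \<in> C" for z
    using that C d xy by (intro imageI) (auto intro: median_closedD median_in_interval)
  have contract: "dist (median x c (median d y a)) (median x c (median d y b)) \<le> dist a b" for a b
    by (rule order_trans[OF median_lipschitz median_lipschitz])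
  have "has_cube n ?C"
  proof (rule Suc.IH)
    show "median_closed ?C" using C by (rule median_closed_shore)
    show "x' \<in> ?C \<inter> h" "y' \<in> ?C - h"
      using in_C xy c d h by (auto simp: x'_def y'_def)
    show "x' \<in> closure (?C - h)"
      unfolding closure_approachable
    proof (intro allI impI)
      fix \<epsilon> :: real assume "\<epsilon> > 0"
      then obtain z where z: "z \<in> C" "z \<notin> h" "dist x z < \<epsilon>"
        using near_x by blast
      have "median x c (median d y z) \<in> ?C - h"
        using in_C z c xy h by auto
      then show "\<exists>u\<in>?C - h. dist u x' < \<epsilon>"
        using contract[of z x] z(3) by (force simp: x'_def dist_commute)
    qed
    show "y' \<in> closure (?C \<inter> h)"
      unfolding closure_approachable
    proof (intro allI impI)
      fix \<epsilon> :: real assume "\<epsilon> > 0"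
      then obtain z where z: "z \<in> C" "z \<in> h" "dist y z < \<epsilon>"
        using near_y by blast
      have "median x c (median d y z) \<in> ?C \<inter> h"
        using in_C z d xy h by auto
      then show "\<exists>u\<in>?C \<inter> h. dist u y' < \<epsilon>"
        using contract[of z y] z(3) by (force simp: y'_def dist_commute)
    qed
  qed
  then show ?case
    using has_cube_Suc[OF C] xy c d disj by blast
qed

text \<open>Both intervals run from outside to inside every \<open>g j\<close> with
  \<open>0 < j\<close>, so the projections preserve membership in these. The approximating points
  record strictness of the chain inside \<open>C\<close> near \<open>x\<close>, in a form that
  passes to the shore.\<close>

lemma cube_if_chain_accumulates:
  fixes g :: "nat \<Rightarrow> 'a::median_space set"
  assumes "median_closed C" "x \<in> C"
    and "\<And>i. i < n \<Longrightarrow> halfspace (g i)" "\<And>i j. i < j \<Longrightarrow> j < n \<Longrightarrow> g j \<subseteq> g i"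
    and "\<And>i. i < n \<Longrightarrow> x \<notin> g i"
    and "\<And>i \<epsilon>. i < n \<Longrightarrow> \<epsilon> > 0 \<Longrightarrow>
      \<exists>p\<in>C. dist x p < \<epsilon> \<and> p \<in> g i \<and> (\<forall>j. i < j \<longrightarrow> j < n \<longrightarrow> p \<notin> g j)"
  shows "has_cube n C"
  using assms
proof (induction n arbitrary: C x g)
  case 0
  then show ?case by (blast intro: has_cube_0)
next
  case (Suc n)
  note C = Suc.prems(1) and x = Suc.prems(2) and g = Suc.prems(3) and mono = Suc.prems(4)
    and x_notin = Suc.prems(5) and near = Suc.prems(6)
  note hs = median_in_halfspace[OF g]
  have last: "z \<in> g i" if "z \<in> g n" "i \<le> n" for z i
    using that mono[of i n] by (cases "i = n") auto
  obtain b where b: "b \<in> C" "b \<in> g n"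
    using near[of n 1] by auto
  obtain a0 where a0: "a0 \<in> C" "a0 \<in> g 0" "\<And>j. 0 < j \<Longrightarrow> j < Suc n \<Longrightarrow> a0 \<notin> g j"
    using near[of 0 1] by auto
  \<comment> \<open>Moving \<open>a0\<close> between \<open>x\<close> and \<open>b\<close> keeps its
    membership in each \<open>g j\<close> and puts the whole interval from \<open>a\<close> to
    \<open>b\<close> at distance at least \<open>dist x a\<close> from \<open>x\<close>.\<close>
  define a where "a = median x b a0"
  have a: "a \<in> C" "a \<in> g 0" "\<And>j. 0 < j \<Longrightarrow> j < Suc n \<Longrightarrow> a \<notin> g j" "a \<in> metric_interval x b"
    using a0 b x C last[of b 0] hs x_notin
    by (auto simp: a_def intro: median_closedD median_in_interval)
  have "dist x a > 0"
    using a(2) x_notin[of 0] by auto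
  \<comment> \<open>Being closer to \<open>x\<close> than \<open>a\<close>, the point
    \<open>b'\<close> spans with \<open>x\<close> an interval that cannot reach the one from
    \<open>a\<close> to \<open>b\<close>.\<close>
  then obtain b' where b': "b' \<in> C" "b' \<in> g n" "dist x b' < dist x a"
    using near[of n] by blast
  have disj: "metric_interval x b' \<inter> metric_interval a b = {}"
  proof (rule ccontr)
    assume "\<not> ?thesis"
    then obtain z where z: "z \<in> metric_interval x b'" "z \<in> metric_interval a b" by blast
    have "a \<in> metric_interval x z"
      using a(4) z(2) by (rule interval_trans_right)
    then show False
      using z(1) b'(3) zero_le_dist[of a z] zero_le_dist[of z b']
      unfolding in_metric_interval by linarith
  qed
  let ?C = "median x b' ` (C \<inter> metric_interval a b)"
  define x' where "x' = median x b' (median a b x)"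
  have in_C: "median x b' (median a b z) \<in> ?C" if "z \<in> C" for z
    using that C a b by (intro imageI) (auto intro: median_closedD median_in_interval)
  have contract: "dist (median x b' (median a b u)) (median x b' (median a b v)) \<le> dist u v" for u v
    by (rule order_trans[OF median_lipschitz median_lipschitz])
  have "has_cube n ?C"
  proof (rule Suc.IH[of ?C x' "\<lambda>i. g (Suc i)"])
    show "median_closed ?C" using C by (rule median_closed_shore)
    show "x' \<in> ?C" using in_C x by (simp add: x'_def)
    show "halfspace (g (Suc i))" if "i < n" for i
      using g that by simp
    show "g (Suc j) \<subseteq> g (Suc i)" if "i < j" "j < n" for i j
      using mono that by simp
    show "x' \<notin> g (Suc i)" if "i < n" for i
      using that a(3) x_notin hs[of "Suc i"] by (simp add: x'_def)
    show "\<exists>p\<in>?C. dist x' p < \<epsilon> \<and> p \<in> g (Suc i) \<and> (\<forall>j. i < j \<longrightarrow> j < n \<longrightarrow> p \<notin> g (Suc j))"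
      if i: "i < n" and "\<epsilon> > 0" for i \<epsilon>
    proof -
      obtain p where p: "p \<in> C" "dist x p < \<epsilon>" "p \<in> g (Suc i)"
        "\<And>j. Suc i < j \<Longrightarrow> j < Suc n \<Longrightarrow> p \<notin> g j"
        using near[OF Suc_mono[OF i] \<open>\<epsilon> > 0\<close>] by blast
      show ?thesis
      proof (intro bexI conjI allI impI)
        show "median x b' (median a b p) \<in> ?C" using in_C p(1) .
        show "dist x' (median x b' (median a b p)) < \<epsilon>"
          using contract[of x p] p(2) by (simp add: x'_def)
        show "median x b' (median a b p) \<in> g (Suc i)"
          using i p(3) last[OF b(2), of "Suc i"] last[OF b'(2), of "Suc i"] hs[of "Suc i"] by simp
        show "median x b' (median a b p) \<notin> g (Suc j)" if "i < j" "j < n" for j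
          using that p(4) a(3) x_notin hs[of "Suc j"] by simp
      qed
    qed
  qed
  then show ?case
    using has_cube_Suc[OF C] x a(1) b(1) b'(1) disj by blast
qed

lemma cube_if_strict_chain:
  fixes g :: "nat \<Rightarrow> 'a::median_space set"
  assumes g: "\<And>i. i \<le> n \<Longrightarrow> halfspace (g i)" and strict: "\<And>i. i < n \<Longrightarrow> g (Suc i) \<subset> g i"
    and x: "x \<notin> g 0" "x \<in> closure (g n)"
  shows "has_cube (Suc n) (UNIV :: 'a set)"
proof -
  have mono: "g j \<subseteq> g i" if "i \<le> j" "j \<le> n" for i j
    using that
  proof (induction rule: dec_induct)
    case (step k)
    then show ?case using strict[of k] by auto
  qed auto
  show ?thesis
  proof (rule cube_if_chain_accumulates[of _ x _ g])
    show "median_closed (UNIV :: 'a set)" by (simp add: median_closed_def)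
    show "x \<notin> g i" if "i < Suc n" for i
      using mono[of 0 i] x(1) that by auto
    fix i :: nat and \<epsilon> :: real
    assume i: "i < Suc n" and "\<epsilon> > 0"
    then obtain b where b: "b \<in> g n" "dist x b < \<epsilon>"
      using x(2) by (auto simp: closure_approachable dist_commute)
    show "\<exists>p\<in>UNIV. dist x p < \<epsilon> \<and> p \<in> g i \<and> (\<forall>j. i < j \<longrightarrow> j < Suc n \<longrightarrow> p \<notin> g j)"
    proof (cases "i = n")
      case True
      with b show ?thesis by auto
    next
      case False
      then obtain a where a: "a \<in> g i" "a \<notin> g (Suc i)"
        using strict[of i] i by auto
      \<comment> \<open>However far \<open>a\<close> is, this median is as near to \<open>x\<close>
        as \<open>b\<close>; it sides with \<open>a\<close> and \<open>b\<close> for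
        \<open>g i\<close>, and with \<open>a\<close> and \<open>x\<close> for the later
        members.\<close>
      have "median x b a \<in> metric_interval x b" by (rule median_in_interval)
      then have "dist x (median x b a) < \<epsilon>"
        using b(2) zero_le_dist[of "median x b a" b] unfolding in_metric_interval by linarith
      moreover have "median x b a \<in> g i"
        using i a(1) b(1) mono[of i n] by (intro median_in_halfspace(3)[OF g]) auto
      moreover have "median x b a \<notin> g j" if "i < j" "j < Suc n" for j
        using that a(2) x(1) mono[of "Suc i" j] mono[of 0 j]
        by (intro median_in_halfspace(5)[OF g]) auto
      ultimately show ?thesis by blast
    qed
  qed (use g mono in auto)
qed

section \<open>Rank bound and conclusion\<close>

lemma cube_le_rank:
  assumes "has_cube n (UNIV :: 'a::median_space set)"
  shows "enat n \<le> median_rank TYPE('a)"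
  using assms unfolding has_cube_def median_rank_def by (auto intro: SUP_upper)

lemma halfspace_Compl: "halfspace h \<Longrightarrow> halfspace (- h)"
  by (auto simp: halfspace_def)

theorem proposition2:
  assumes finite_rank: "median_rank TYPE('a::{median_space, complete_space}) \<noteq> \<infinity>"
  shows "(\<forall>h :: 'a set. halfspace h \<longrightarrow> open h \<or> closed h) \<and>
    (\<forall>(k :: nat) (h :: nat \<Rightarrow> 'a set).
      (\<forall>i\<in>{1..k}. halfspace (h i)) \<longrightarrow>
      (\<forall>i\<in>{1..<k}. h (i + 1) \<subset> h i) \<longrightarrow>
      enat k > 2 * median_rank TYPE('a) \<longrightarrow>
      closure (h k) \<subseteq> interior (h 1))"
proof -
  obtain r where r: "median_rank TYPE('a) = enat r"
    using finite_rank by auto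
  have no_cube: "\<not> has_cube (Suc r) (UNIV :: 'a set)"
    using cube_le_rank[where 'a = 'a, of "Suc r"] r by auto
  show ?thesis
  proof (intro conjI allI impI subsetI)
    fix h :: "'a set"
    assume h: "halfspace h"
    show "open h \<or> closed h"
    proof (rule ccontr)
      assume "\<not> ?thesis"
      then have "\<not> closure (- h) \<subseteq> - h" "\<not> closure h \<subseteq> h"
        by (simp_all add: closure_subset_eq open_closed)
      then obtain x y where "x \<in> h" "x \<in> closure (- h)" "y \<notin> h" "y \<in> closure h"
        by blast
      then have "has_cube (Suc r) (UNIV :: 'a set)"
        by (intro cube_if_neither_open_nor_closed[OF h, of _ x y])
          (auto simp: median_closed_def Compl_eq_Diff_UNIV)
      with no_cube show False ..
    qed
  next
    fix k :: nat and h :: "nat \<Rightarrow> 'a set" and x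
    assume hs: "\<forall>i\<in>{1..k}. halfspace (h i)" and strict: "\<forall>i\<in>{1..<k}. h (i + 1) \<subset> h i"
      and "enat k > 2 * median_rank TYPE('a)" and x: "x \<in> closure (h k)"
    then have k: "2 * r < k"
      by (simp add: r numeral_eq_enat)
    have mono: "h j \<subseteq> h i" if "i \<le> j" "1 \<le> i" "j \<le> k" for i j
      using that
    proof (induction rule: dec_induct)
      case (step m)
      then show ?case using bspec[OF strict, of m] by auto
    qed auto
    show "x \<in> interior (h 1)"
    proof (rule ccontr)
      assume "x \<notin> interior (h 1)"
      then have x': "x \<in> closure (- h 1)"
        by (simp add: closure_complement)
      have "has_cube (Suc r) (UNIV :: 'a set)"
      \<comment> \<open>\<open>h (r + 1)\<close> is the middle of the first \<open>2 * r + 1\<close>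
        members. If it contains \<open>x\<close>, the complements of \<open>h (r + 1)\<close> down
        to \<open>h 1\<close> decrease and avoid \<open>x\<close>; otherwise
        \<open>h (r + 1)\<close> up to \<open>h (2 * r + 1)\<close> do. Either way there are
        \<open>r + 1\<close> halfspaces.\<close>
      proof (cases "x \<in> h (r + 1)")
        case True
        show ?thesis
        proof (rule cube_if_strict_chain[of r "\<lambda>i. - h (r + 1 - i)" x])
          show "halfspace (- h (r + 1 - i))" if "i \<le> r" for i
          proof (rule halfspace_Compl)
            have "r + 1 - i \<in> {1..k}"
              using that k by auto
            then show "halfspace (h (r + 1 - i))"
              using hs by blast
          qed
          show "- h (r + 1 - Suc i) \<subset> - h (r + 1 - i)" if "i < r" for i
          proof -
            have "r - i \<in> {1..<k}"
              using that k by auto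
            then show ?thesis
              using bspec[OF strict, of "r - i"] that by (auto simp: Suc_diff_le)
          qed
        qed (use True x' in auto)
      next
        case False
        show ?thesis
        proof (rule cube_if_strict_chain[of r "\<lambda>i. h (r + 1 + i)" x])
          show "x \<in> closure (h (r + 1 + r))"
            using x closure_mono[of "h k" "h (r + 1 + r)"] mono[of "r + 1 + r" k] k by auto
        qed (use hs strict k False in auto)
      qed
      with no_cube show False ..
    qed
  qed
qed

end
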